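(* Let $1\le\tau\le\sqrt2$. Then every minimizer of the action $S$ on the circle $S^1$ (with parameter $\tau$) is generically timelike.
   Context: Let $F=S^1\subset\mathbb{R}^2$ be the unit circle and, for a parameter $\tau\ge1$, let $$D(x,y)=2\tau^2\,(1+\langle x,y\rangle)\,\big(2-\tau^2(1-\langle x,y\rangle)\big),\qquad x,y\in F,$$ where $\langle\cdot,\cdot\rangle$ is the Euclidean scalar product, and $L=\max(0,D)$. $\mathfrak{M}$ is the set of all normalized (total mass one) positive regular Borel measures on $F$; $S[\rho]=\iint_{F\times F}L(x,y)\,d\rho(x)\,d\rho(y)$. A minimizer is a $\rho\in\mathfrak{M}$ with $S[\rho]=\inf_{\tilde\rho\in\mathfrak{M}}S[\tilde\rho]$. A minimizer $\rho$ is called generically timelike if (i) $D(x,y)\ge0$ for all $x,y\in\operatorname{supp}\rho$, and (ii) the function $d(x)=\int_FD(x,y)\,d\rho(y)$ is constant on $F$. *)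

theory Defs
  imports "HOL-Probability.Probability"
begin

abbreviation circle :: "(real ^ 2) set" where
  "circle \<equiv> sphere 0 1"

definition D :: "real \<Rightarrow> real ^ 2 \<Rightarrow> real ^ 2 \<Rightarrow> real" where
  "D \<tau> x y = 2 * \<tau>\<^sup>2 * (1 + x \<bullet> y) * (2 - \<tau>\<^sup>2 * (1 - x \<bullet> y))"

definition Lagr :: "real \<Rightarrow> real ^ 2 \<Rightarrow> real ^ 2 \<Rightarrow> real" where
  "Lagr \<tau> x y = max 0 (D \<tau> x y)"

definition regular_borel_measure_on :: "'a::topological_space set \<Rightarrow> 'a measure \<Rightarrow> bool" where
  "regular_borel_measure_on F \<mu> \<longleftrightarrow>
     sets \<mu> = sets (restrict_space borel F) \<and>
     (\<forall>A\<in>sets \<mu>.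
        emeasure \<mu> A = (SUP K\<in>{K. K \<subseteq> A \<and> compact K}. emeasure \<mu> K) \<and>
        emeasure \<mu> A = (INF U\<in>{U. A \<subseteq> U \<and> openin (top_of_set F) U}. emeasure \<mu> U))"

definition normalized_measures :: "(real ^ 2) measure set" where
  "normalized_measures = {\<rho>. regular_borel_measure_on circle \<rho> \<and> emeasure \<rho> circle = 1}"

definition action :: "real \<Rightarrow> (real ^ 2) measure \<Rightarrow> real" where
  "action \<tau> \<rho> = (\<integral>p. Lagr \<tau> (fst p) (snd p) \<partial>(\<rho> \<Otimes>\<^sub>M \<rho>))"

definition minimizer :: "real \<Rightarrow> (real ^ 2) measure \<Rightarrow> bool" where
  "minimizer \<tau> \<rho> \<longleftrightarrow>
     \<rho> \<in> normalized_measures \<and> action \<tau> \<rho> = (INF \<rho>'\<in>normalized_measures. action \<tau> \<rho>')"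

definition supp :: "'a::topological_space measure \<Rightarrow> 'a set" where
  "supp \<mu> = {x \<in> space \<mu>. \<forall>U. openin (top_of_set (space \<mu>)) U \<and> x \<in> U \<longrightarrow> emeasure \<mu> U > 0}"

definition generically_timelike :: "real \<Rightarrow> (real ^ 2) measure \<Rightarrow> bool" where
  "generically_timelike \<tau> \<rho> \<longleftrightarrow>
     minimizer \<tau> \<rho> \<and>
     (\<forall>x\<in>supp \<rho>. \<forall>y\<in>supp \<rho>. D \<tau> x y \<ge> 0) \<and>
     (\<lambda>x. \<integral>y. D \<tau> x y \<partial>\<rho>) constant_on circle"

end

theory Submission
  imports Defs
begin

text \<open>
  On the circle, \<open>D\<close> depends on the angle \<open>\<theta>\<close> between its arguments through
  \<open>4\<tau>\<^sup>2 - \<tau>\<^sup>4 + 4\<tau>\<^sup>2 cos \<theta> + \<tau>\<^sup>4 cos 2\<theta>\<close>. All Fourier coefficients being positive,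
  the double integral of \<open>D\<close> is at least \<open>4\<tau>\<^sup>2 - \<tau>\<^sup>4\<close>, with equality iff the first two Fourier
  moments of the measure vanish, in which case \<open>d\<close> is constant. As the Lagrangian dominates \<open>D\<close>,
  the action is bounded below by the same number, and for \<open>\<tau> \<le> \<surd>2\<close> the uniform measure on the
  corners of a square attains it, because \<open>D\<close> is nonnegative on those corners. Hence a minimizer
  has equality in both estimates: \<open>d\<close> is constant, and \<open>D < 0\<close> only on a null set of the product
  measure, which by continuity excludes pairs in the support.
\<close>

section \<open>Harmonic form of \<open>D\<close> on the circle\<close>

lemma D_Fourier:
  assumes "x \<in> circle" "y \<in> circle"
  shows "D \<tau> x y = 4 * \<tau>\<^sup>2 - \<tau>^4 + 4 * \<tau>\<^sup>2 * (x$1 * y$1 + x$2 * y$2)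
     + \<tau>^4 * (((x$1)\<^sup>2 - (x$2)\<^sup>2) * ((y$1)\<^sup>2 - (y$2)\<^sup>2) + (2 * x$1 * x$2) * (2 * y$1 * y$2))"
proof -
  have x: "(x$1)\<^sup>2 = 1 - (x$2)\<^sup>2" and y: "(y$1)\<^sup>2 = 1 - (y$2)\<^sup>2"
    using assms by (simp_all add: norm_eq_1 inner_vec_def sum_2 power2_eq_square)
  \<comment> \<open>The addition theorem cos 2(a - b) = cos 2a cos 2b + sin 2a sin 2b in Cartesian
    coordinates. It splits the second harmonic into products of a factor in \<open>x\<close> and a
    factor in \<open>y\<close>.\<close>
  have "2 * (x$1 * y$1 + x$2 * y$2)\<^sup>2 - 1
      = ((x$1)\<^sup>2 - (x$2)\<^sup>2) * ((y$1)\<^sup>2 - (y$2)\<^sup>2) + (2 * x$1 * x$2) * (2 * y$1 * y$2)"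
    unfolding power2_sum power_mult_distrib x y by (simp add: algebra_simps power2_eq_square)
  moreover have "D \<tau> x y = 4 * \<tau>\<^sup>2 - \<tau>^4 + 4 * \<tau>\<^sup>2 * (x \<bullet> y) + \<tau>^4 * (2 * (x \<bullet> y)\<^sup>2 - 1)"
    unfolding D_def by algebra
  ultimately show ?thesis
    by (simp add: inner_vec_def sum_2)
qed

lemma continuous_D: "continuous_on UNIV (\<lambda>p. D \<tau> (fst p) (snd p))"
  unfolding D_def by (intro continuous_intros)

lemma continuous_Lagr: "continuous_on UNIV (\<lambda>p. Lagr \<tau> (fst p) (snd p))"
  unfolding Lagr_def by (intro continuous_on_max continuous_on_const continuous_D)

section \<open>Integration against a probability measure on the circle\<close>

locale circle_prob = prob_space \<rho> for \<rho> :: "(real ^ 2) measure" +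
  assumes sets_eq: "sets \<rho> = sets (restrict_space borel circle)"
begin

lemma space_eq: "space \<rho> = circle"
  using sets_eq_imp_space_eq[OF sets_eq] by (simp add: space_restrict_space)

sublocale pair: pair_prob_space \<rho> \<rho> ..

lemma id_measurable: "(\<lambda>x. x) \<in> \<rho> \<rightarrow>\<^sub>M borel"
  unfolding measurable_cong_sets[OF sets_eq refl] by (rule measurable_restrict_space1) simp

lemma integrable_continuous:
  fixes f :: "real ^ 2 \<Rightarrow> real"
  assumes "continuous_on UNIV f"
  shows "integrable \<rho> f"
proof -
  have "compact (f ` circle)"
    using assms by (intro compact_continuous_image) (auto intro: continuous_on_subset)
  then obtain B where "\<forall>x\<in>circle. norm (f x) \<le> B"
    using compact_imp_bounded by (fastforce simp: bounded_iff)
  moreover have "f \<in> borel_measurable \<rho>"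
    using measurable_compose[OF id_measurable borel_measurable_continuous_onI[OF assms]] .
  ultimately show ?thesis
    by (intro integrable_const_bound[where B = B] AE_I2) (auto simp: space_eq)
qed

lemma integrable_pair_continuous:
  fixes f :: "(real ^ 2) \<times> (real ^ 2) \<Rightarrow> real"
  assumes "continuous_on UNIV f"
  shows "integrable (\<rho> \<Otimes>\<^sub>M \<rho>) f"
proof -
  have "compact (f ` (circle \<times> circle))"
    using assms
    by (intro compact_continuous_image compact_Times) (auto intro: continuous_on_subset)
  then obtain B where "\<forall>x\<in>circle \<times> circle. norm (f x) \<le> B"
    using compact_imp_bounded by (fastforce simp: bounded_iff)
  \<comment> \<open>The product space carries traces of Borel sets on the circle, so measurability
    of \<open>f\<close> is pulled back along the identity into \<open>borel\<close>.\<close>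
  moreover have "(\<lambda>p. p) \<in> \<rho> \<Otimes>\<^sub>M \<rho> \<rightarrow>\<^sub>M borel"
    unfolding borel_prod[symmetric]
    by (rule measurable_pair)
      (use measurable_compose[OF measurable_fst id_measurable, of \<rho>]
        measurable_compose[OF measurable_snd id_measurable, of \<rho>] in \<open>simp_all add: comp_def\<close>)
  then have "f \<in> borel_measurable (\<rho> \<Otimes>\<^sub>M \<rho>)"
    using measurable_compose[OF _ borel_measurable_continuous_onI[OF assms]] by blast
  ultimately show ?thesis
    by (intro pair.integrable_const_bound[where B = B] AE_I2)
      (auto simp: space_eq space_pair_measure)
qed

lemma integral_pair_continuous:
  fixes f :: "(real ^ 2) \<times> (real ^ 2) \<Rightarrow> real"
  assumes "continuous_on UNIV f"
  shows "(\<integral>p. f p \<partial>(\<rho> \<Otimes>\<^sub>M \<rho>)) = (\<integral>x. \<integral>y. f (x, y) \<partial>\<rho> \<partial>\<rho>)"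
  using pair.integral_fst'[OF integrable_pair_continuous[OF assms]] by simp

text \<open>\<open>mom1\<close> and \<open>mom2\<close> are the integrals of cos and sin of the
  polar angle, \<open>mom3\<close> and \<open>mom4\<close> those of its double.\<close>

definition "mom1 = (\<integral>y. y$1 \<partial>\<rho>)"
definition "mom2 = (\<integral>y. y$2 \<partial>\<rho>)"
definition "mom3 = (\<integral>y. (y$1)\<^sup>2 - (y$2)\<^sup>2 \<partial>\<rho>)"
definition "mom4 = (\<integral>y. 2 * y$1 * y$2 \<partial>\<rho>)"

lemma integrable_moments:
  "integrable \<rho> (\<lambda>y. y$1)" "integrable \<rho> (\<lambda>y. y$2)"
  "integrable \<rho> (\<lambda>y. (y$1)\<^sup>2 - (y$2)\<^sup>2)" "integrable \<rho> (\<lambda>y. 2 * y$1 * y$2)"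
  by (intro integrable_continuous continuous_intros)+

text \<open>Stated with free coefficients because it serves twice: for the inner integral they come
  from the coordinates of the fixed point, for the outer one they are the moments
  themselves.\<close>

lemma integral_affine_moments:
  "(\<integral>y. c + a * (s * y$1 + t * y$2) + b * (u * ((y$1)\<^sup>2 - (y$2)\<^sup>2) + v * (2 * y$1 * y$2)) \<partial>\<rho>)
    = c + a * (s * mom1 + t * mom2) + b * (u * mom3 + v * mom4)"
  using integrable_moments by (simp add: mom1_def mom2_def mom3_def mom4_def prob_space)

lemma integral_D:
  assumes "x \<in> circle"
  shows "(\<integral>y. D \<tau> x y \<partial>\<rho>) = 4 * \<tau>\<^sup>2 - \<tau>^4 + 4 * \<tau>\<^sup>2 * (x$1 * mom1 + x$2 * mom2)
     + \<tau>^4 * (((x$1)\<^sup>2 - (x$2)\<^sup>2) * mom3 + (2 * x$1 * x$2) * mom4)"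
  unfolding integral_affine_moments[symmetric]
  by (intro Bochner_Integration.integral_cong refl D_Fourier assms) (simp add: space_eq)

text \<open>Each harmonic is a sum of terms g(x) g(y), so integrating both variables squares the
  moment of g.\<close>

lemma double_integral_D:
  "(\<integral>p. D \<tau> (fst p) (snd p) \<partial>(\<rho> \<Otimes>\<^sub>M \<rho>))
    = 4 * \<tau>\<^sup>2 - \<tau>^4 + 4 * \<tau>\<^sup>2 * (mom1\<^sup>2 + mom2\<^sup>2) + \<tau>^4 * (mom3\<^sup>2 + mom4\<^sup>2)"
proof -
  have "(\<integral>p. D \<tau> (fst p) (snd p) \<partial>(\<rho> \<Otimes>\<^sub>M \<rho>)) = (\<integral>x. \<integral>y. D \<tau> x y \<partial>\<rho> \<partial>\<rho>)"
    using integral_pair_continuous[OF continuous_D] by simp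
  also have "\<dots> = (\<integral>x. 4 * \<tau>\<^sup>2 - \<tau>^4 + 4 * \<tau>\<^sup>2 * (mom1 * x$1 + mom2 * x$2)
     + \<tau>^4 * (mom3 * ((x$1)\<^sup>2 - (x$2)\<^sup>2) + mom4 * (2 * x$1 * x$2)) \<partial>\<rho>)"
    by (intro Bochner_Integration.integral_cong refl, subst integral_D)
      (simp_all add: space_eq mult.commute)
  finally show ?thesis
    unfolding integral_affine_moments by (simp add: power2_eq_square)
qed

lemma action_ge_double_integral_D:
  "(\<integral>p. D \<tau> (fst p) (snd p) \<partial>(\<rho> \<Otimes>\<^sub>M \<rho>)) \<le> action \<tau> \<rho>"
  unfolding action_def
  by (intro integral_mono integrable_pair_continuous continuous_D continuous_Lagr)
    (simp add: Lagr_def)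

text \<open>A pair in the support with \<open>D\<close> negative would have a product neighbourhood
  of positive measure on which the Lagrangian strictly exceeds \<open>D\<close>, making the two
  integrals differ.\<close>

lemma D_nonneg_on_supp:
  assumes act: "action \<tau> \<rho> = (\<integral>p. D \<tau> (fst p) (snd p) \<partial>(\<rho> \<Otimes>\<^sub>M \<rho>))"
    and x: "x \<in> supp \<rho>" and y: "y \<in> supp \<rho>"
  shows "D \<tau> x y \<ge> 0"
proof (rule ccontr)
  assume neg: "\<not> D \<tau> x y \<ge> 0"
  let ?E = "\<lambda>p. Lagr \<tau> (fst p) (snd p) - D \<tau> (fst p) (snd p)"
  have int: "integrable (\<rho> \<Otimes>\<^sub>M \<rho>) ?E"
    by (intro integrable_pair_continuous continuous_on_diff continuous_D continuous_Lagr)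
  have "(\<integral>p. ?E p \<partial>(\<rho> \<Otimes>\<^sub>M \<rho>)) = 0"
    using act unfolding action_def
    by (simp add: integrable_pair_continuous[OF continuous_D]
        integrable_pair_continuous[OF continuous_Lagr])
  then have "AE p in \<rho> \<Otimes>\<^sub>M \<rho>. ?E p = 0"
    by (subst (asm) integral_nonneg_eq_0_iff_AE[OF int]) (auto simp: Lagr_def)
  then have ae: "AE p in \<rho> \<Otimes>\<^sub>M \<rho>. D \<tau> (fst p) (snd p) \<ge> 0"
    by eventually_elim (simp add: Lagr_def)
  have "open {p. D \<tau> (fst p) (snd p) < 0}"
    by (intro open_Collect_less continuous_D continuous_on_const)
  moreover have "(x, y) \<in> {p. D \<tau> (fst p) (snd p) < 0}"
    using neg by simp
  ultimately obtain U V where UV: "open U" "open V" "x \<in> U" "y \<in> V"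
    and sub: "U \<times> V \<subseteq> {p. D \<tau> (fst p) (snd p) < 0}"
    by (rule open_prod_elim) (use that in auto)
  \<comment> \<open>Neighbourhoods are cut down to the circle, since \<open>supp\<close> tests
    relatively open sets.\<close>
  have pos: "emeasure \<rho> (circle \<inter> W) > 0" if "open W" "z \<in> W" "z \<in> supp \<rho>" for W z
    using that unfolding supp_def space_eq by (auto simp: openin_open_Int)
  have meas: "circle \<inter> W \<in> sets \<rho>" if "open W" for W
    using that by (simp add: sets_eq sets_restrict_space)
  have "AE p in \<rho> \<Otimes>\<^sub>M \<rho>. p \<notin> (circle \<inter> U) \<times> (circle \<inter> V)"
    using ae by eventually_elim (use sub in force)
  then have "emeasure (\<rho> \<Otimes>\<^sub>M \<rho>) ((circle \<inter> U) \<times> (circle \<inter> V)) = 0"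
    using UV by (subst (asm) AE_iff_null_sets[symmetric]) (auto intro: meas)
  then have "emeasure \<rho> (circle \<inter> U) * emeasure \<rho> (circle \<inter> V) = 0"
    using UV by (simp add: meas emeasure_pair_measure_Times)
  then show False
    using pos UV x y by force
qed

end

lemma circle_prob_normalized:
  assumes "\<rho> \<in> normalized_measures"
  shows "circle_prob \<rho>"
proof -
  have sets: "sets \<rho> = sets (restrict_space borel circle)" and "emeasure \<rho> circle = 1"
    using assms by (auto simp: normalized_measures_def regular_borel_measure_on_def)
  moreover from sets have "space \<rho> = circle"
    using sets_eq_imp_space_eq[OF sets] by (simp add: space_restrict_space)
  ultimately show ?thesis
    by (intro circle_prob.intro circle_prob_axioms.intro prob_spaceI) simp_all
qed

section \<open>The competitor carried by a square\<close>

definition corner :: "bool \<times> bool \<Rightarrow> real ^ 2" where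
  "corner = (\<lambda>(a, b). (if a then 1 else - 1) *\<^sub>R axis (if b then 1 else 2) 1)"

text \<open>Pushing forward the uniform distribution on the four-element index type turns integrals
  into sums over two bits.\<close>

definition square_measure :: "(real ^ 2) measure" where
  "square_measure = distr (measure_pmf (pmf_of_set UNIV)) (restrict_space borel circle) corner"

lemma corner_in_circle: "corner s \<in> circle"
  by (auto simp: corner_def split: prod.split)

lemma corner_measurable:
  "corner \<in> measure_pmf p \<rightarrow>\<^sub>M restrict_space borel circle"
  by (rule measurable_restrict_space2) (use corner_in_circle in auto)

lemma emeasure_square_measure:
  assumes "A \<in> sets (restrict_space borel circle)"
  shows "emeasure square_measure A = emeasure (measure_pmf (pmf_of_set UNIV)) (corner -` A)"
  unfolding square_measure_def using assms
  by (subst emeasure_distr[OF corner_measurable]) auto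

text \<open>The mass of a measurable set depends only on which corners it contains, so both
  regularity conditions are attained by explicit sets.\<close>

lemma square_measure_normalized: "square_measure \<in> normalized_measures"
proof -
  let ?N = "restrict_space borel circle :: (real ^ 2) measure"
  have sets: "sets square_measure = sets ?N"
    by (simp add: square_measure_def)
  have in_N: "B \<inter> circle \<in> sets ?N" if "B \<in> sets borel" for B
    using that by (auto simp: sets_restrict_space)
  \<comment> \<open>Only the larger set has to be measurable, so compact subsets need no separate
    argument.\<close>
  have mono: "emeasure square_measure A \<le> emeasure square_measure B"
    if "A \<subseteq> B" "B \<in> sets ?N" for A B
    using that by (intro emeasure_mono) (simp_all add: sets)
  have inner_regular: "emeasure square_measure A
      = (SUP K\<in>{K. K \<subseteq> A \<and> compact K}. emeasure square_measure K)"
    if A: "A \<in> sets ?N" for A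
  proof (rule antisym)
    \<comment> \<open>The corners inside \<open>A\<close> form a finite, hence compact, set with the
      full mass of \<open>A\<close>.\<close>
    let ?K = "A \<inter> range corner"
    have fin: "finite ?K"
      by simp
    have "?K \<inter> circle \<in> sets ?N"
      by (intro in_N borel_closed finite_imp_closed fin)
    moreover have "?K \<inter> circle = ?K"
      using corner_in_circle by auto
    ultimately have "emeasure square_measure ?K = emeasure square_measure A"
      using A by (simp add: emeasure_square_measure vimage_def)
    moreover have "compact ?K"
      using fin by (rule finite_imp_compact)
    ultimately show "emeasure square_measure A
        \<le> (SUP K\<in>{K. K \<subseteq> A \<and> compact K}. emeasure square_measure K)"
      by (intro SUP_upper2[where i = ?K]) auto
  qed (use A mono in \<open>auto intro!: SUP_least\<close>)
  have outer_regular: "emeasure square_measure A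
      = (INF U\<in>{U. A \<subseteq> U \<and> openin (top_of_set circle) U}. emeasure square_measure U)"
    if A: "A \<in> sets ?N" for A
  proof (rule antisym)
    \<comment> \<open>Deleting the finitely many corners outside \<open>A\<close> leaves a
      relatively open set with no extra mass.\<close>
    let ?U = "- (range corner - A) \<inter> circle"
    have "open (- (range corner - A))"
      by (intro open_Compl finite_imp_closed) simp
    then have op: "openin (top_of_set circle) ?U" and U: "?U \<in> sets ?N"
      by (auto simp: openin_open intro: in_N)
    have "A \<subseteq> circle"
      using sets.sets_into_space[OF A] by (simp add: space_restrict_space)
    then have "A \<subseteq> ?U"
      by auto
    moreover have "corner -` ?U = corner -` A"
      using corner_in_circle by auto
    then have "emeasure square_measure ?U = emeasure square_measure A"
      using A U by (simp add: emeasure_square_measure)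
    ultimately show "(INF U\<in>{U. A \<subseteq> U \<and> openin (top_of_set circle) U}.
        emeasure square_measure U) \<le> emeasure square_measure A"
      using op by (intro INF_lower2[where i = ?U]) auto
  next
    have "U \<in> sets ?N" if "openin (top_of_set circle) U" for U
      using that in_N by (auto simp: openin_open Int_commute)
    then show "emeasure square_measure A
        \<le> (INF U\<in>{U. A \<subseteq> U \<and> openin (top_of_set circle) U}. emeasure square_measure U)"
      using mono by (auto intro!: INF_greatest)
  qed
  have "circle \<in> sets ?N"
    using in_N[of UNIV] by simp
  moreover have "corner -` circle = UNIV"
    using corner_in_circle by auto
  ultimately have "emeasure square_measure circle = 1"
    using measure_pmf.emeasure_space_1[of "pmf_of_set (UNIV :: (bool \<times> bool) set)"]
    by (simp add: emeasure_square_measure)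
  then show ?thesis
    using inner_regular outer_regular
    by (simp add: normalized_measures_def regular_borel_measure_on_def sets)
qed

lemma integral_square_measure:
  assumes "continuous_on UNIV f"
  shows "(\<integral>x. f x \<partial>square_measure) = (\<Sum>s\<in>UNIV. f (corner s)) / (4 :: real)"
proof -
  have "f \<in> borel_measurable (restrict_space borel circle)"
    by (intro measurable_restrict_space1 borel_measurable_continuous_onI assms)
  then have "(\<integral>x. f x \<partial>square_measure) = (\<integral>s. f (corner s) \<partial>measure_pmf (pmf_of_set UNIV))"
    unfolding square_measure_def by (intro integral_distr corner_measurable)
  then show ?thesis
    by (simp add: integral_pmf_of_set)
qed

lemma action_square_measure:
  assumes "\<tau>\<^sup>2 \<le> 2"
  shows "action \<tau> square_measure = 4 * \<tau>\<^sup>2 - \<tau>^4"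
proof -
  interpret circle_prob square_measure
    by (rule circle_prob_normalized[OF square_measure_normalized])
  have cont: "continuous_on UNIV (\<lambda>y. Lagr \<tau> x y)" for x
    unfolding Lagr_def D_def by (intro continuous_intros)
  have "action \<tau> square_measure
      = (\<integral>x. \<integral>y. Lagr \<tau> x y \<partial>square_measure \<partial>square_measure)"
    unfolding action_def using integral_pair_continuous[OF continuous_Lagr] by simp
  also have "\<dots> = (\<integral>x. (\<Sum>s\<in>UNIV. Lagr \<tau> x (corner s)) / 4 \<partial>square_measure)"
    by (simp add: integral_square_measure cont)
  also have "\<dots> = (\<Sum>t\<in>UNIV. (\<Sum>s\<in>UNIV. Lagr \<tau> (corner t) (corner s)) / 4) / 4"
    by (rule integral_square_measure) (auto simp: Lagr_def D_def intro!: continuous_intros)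
  also have "\<dots> = 4 * \<tau>\<^sup>2 - \<tau>^4"
    using mult_left_mono[OF assms, of "2 * \<tau>\<^sup>2"]
    by (simp add: max_absorb2 UNIV_Times_UNIV[symmetric] UNIV_bool corner_def Lagr_def D_def
        inner_axis_axis algebra_simps diff_divide_distrib power2_eq_square power4_eq_xxxx del: UNIV_Times_UNIV)
  finally show ?thesis .
qed

theorem corollary4p2:
  fixes \<tau> :: real and \<rho> :: "(real ^ 2) measure"
  assumes "1 \<le> \<tau>" and "\<tau> \<le> sqrt 2"
    and "minimizer \<tau> \<rho>"
  shows "generically_timelike \<tau> \<rho>"
proof -
  have tau: "\<tau>\<^sup>2 \<le> 2" "\<tau>\<^sup>2 > 0" "\<tau>^4 > 0"
    using assms(1) power_mono[OF assms(2), of 2] by auto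
  have norm: "\<rho> \<in> normalized_measures"
    and inf: "action \<tau> \<rho> = (INF \<rho>'\<in>normalized_measures. action \<tau> \<rho>')"
    using assms(3) by (auto simp: minimizer_def)
  interpret circle_prob \<rho>
    by (rule circle_prob_normalized[OF norm])
  \<comment> \<open>A real infimum lies below its members only once the set is known to be bounded
    below.\<close>
  have "bdd_below (action \<tau> ` normalized_measures)"
    by (rule bdd_belowI2[of _ 0]) (simp add: action_def Lagr_def)
  then have "action \<tau> \<rho> \<le> action \<tau> square_measure"
    unfolding inf using square_measure_normalized by (rule cINF_lower)
  then have upper: "action \<tau> \<rho> \<le> 4 * \<tau>\<^sup>2 - \<tau>^4"
    by (simp add: action_square_measure tau)
  let ?I = "\<integral>p. D \<tau> (fst p) (snd p) \<partial>(\<rho> \<Otimes>\<^sub>M \<rho>)"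
  have le: "?I \<le> action \<tau> \<rho>"
    by (rule action_ge_double_integral_D)
  have nn: "4 * \<tau>\<^sup>2 * (mom1\<^sup>2 + mom2\<^sup>2) \<ge> 0" "\<tau>^4 * (mom3\<^sup>2 + mom4\<^sup>2) \<ge> 0"
    by simp_all
  \<comment> \<open>The action lies between the constant plus two nonnegative terms and that
    constant, so both terms vanish and every inequality is an equality.\<close>
  have act: "action \<tau> \<rho> = ?I"
    using upper le nn unfolding double_integral_D by linarith
  have "4 * \<tau>\<^sup>2 * (mom1\<^sup>2 + mom2\<^sup>2) = 0" "\<tau>^4 * (mom3\<^sup>2 + mom4\<^sup>2) = 0"
    using upper le nn unfolding double_integral_D by linarith+
  then have "mom1 = 0" "mom2 = 0" "mom3 = 0" "mom4 = 0"
    using tau by (auto simp: sum_power2_eq_zero_iff)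
  then have "(\<lambda>x. \<integral>y. D \<tau> x y \<partial>\<rho>) constant_on circle"
    unfolding constant_on_def by (intro exI[of _ "4 * \<tau>\<^sup>2 - \<tau>^4"]) (simp add: integral_D)
  then show ?thesis
    using assms(3) D_nonneg_on_supp[OF act] by (simp add: generically_timelike_def)
qed

end
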